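(* Let $\mathcal{H}$ be a Hilbert space, let $T$ be a contraction on $\mathcal{H}$, and let $X=(X_1,\ldots,X_n)$ be an $n$-tuple of doubly commuting left-invertible operators on $\mathcal{H}$ such that $X_iT=TX_i$ for all $i\in\{1,\ldots,n\}$. Assume moreover that both $X$ and the corresponding $n$-tuple of Cauchy duals $X'=(X_1',\ldots,X_n')$ possess the wandering subspace property on $\mathcal{H}$. Then the following are equivalent: (i) $T$ is a pure contraction on $\mathcal{H}$; (ii) $P_{\mathcal{W}(X)}T|_{\mathcal{W}(X)}$ is a pure contraction on $\mathcal{W}(X)$.
   Context: Operators are bounded linear operators on complex Hilbert spaces. A contraction ($\|T\|\le 1$) $T$ on $\mathcal{H}$ is pure if $\|T^{*m}h\|\to 0$ as $m\to\infty$ for every $h\in\mathcal{H}$. A tuple $X=(X_1,\ldots,X_n)$ of commuting operators is doubly commuting if $X_i^*X_j=X_jX_i^*$ for all $i\ne j$. The Cauchy dual of a left-invertible operator $A$ is $A'=A(A^*A)^{-1}$ (here $A^*A$ is invertible). The wandering subspace of a tuple $X$ on $\mathcal{H}$ is $\mathcal{W}(X)=\bigcap_{i=1}^n\ker X_i^*=\mathcal{H}\ominus\sum_{i=1}^nX_i\mathcal{H}$. For $\mathbf{k}=(k_1,\ldots,k_n)\in\mathbb{N}^n$ ($0\in\mathbb{N}$), $X^{\mathbf{k}}=X_1^{k_1}\cdots X_n^{k_n}$. A commuting tuple $X$ possesses the wandering subspace property on $\mathcal{H}$ if $\mathcal{H}=\bigvee_{\mathbf{k}\in\mathbb{N}^n}X^{\mathbf{k}}\mathcal{W}(X)$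 (closed linear span). $P_{\mathcal{S}}$ denotes the orthogonal projection onto a closed subspace $\mathcal{S}$. *)

theory Defs
  imports "HOL-Analysis.Analysis"
begin

text \<open>
  Complex Hilbert spaces. The underlying real Hilbert space, with inner product
  \<open>Re \<langle>x, y\<rangle>\<close> and the same norm, is inherited from \<^class>\<open>real_inner\<close>.
  The complex inner product is linear in its first argument.
\<close>

class complex_hilbert_space = real_inner + complete_space +
  fixes scaleC :: "complex \<Rightarrow> 'a \<Rightarrow> 'a"  (infixr \<open>*\<^sub>C\<close> 75)
    and cinner :: "'a \<Rightarrow> 'a \<Rightarrow> complex"
  assumes scaleC_add_right: "a *\<^sub>C (x + y) = a *\<^sub>C x + a *\<^sub>C y"
    and scaleC_add_left: "(a + b) *\<^sub>C x = a *\<^sub>C x + b *\<^sub>C x"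
    and scaleC_scaleC: "a *\<^sub>C b *\<^sub>C x = (a * b) *\<^sub>C x"
    and scaleR_scaleC: "r *\<^sub>R x = complex_of_real r *\<^sub>C x"
    and cinner_commute: "cinner x y = cnj (cinner y x)"
    and cinner_add_left: "cinner (x + y) z = cinner x z + cinner y z"
    and cinner_scaleC_left: "cinner (a *\<^sub>C x) y = a * cinner x y"
    and inner_eq_Re_cinner: "inner x y = Re (cinner x y)"

instance complex_hilbert_space \<subseteq> banach ..

instantiation complex :: complex_hilbert_space
begin

definition scaleC_complex :: "complex \<Rightarrow> complex \<Rightarrow> complex" where
  "scaleC_complex a x = a * x"

definition cinner_complex :: "complex \<Rightarrow> complex \<Rightarrow> complex" where
  "cinner_complex x y = x * cnj y"

instance
  by standard
    (auto simp: scaleC_complex_def cinner_complex_def algebra_simps scaleR_conv_of_real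
      inner_complex_def)

end

global_interpretation cvec: vector_space "scaleC :: complex \<Rightarrow> 'a \<Rightarrow> 'a::complex_hilbert_space"
proof
  fix x :: 'a
  show "1 *\<^sub>C x = x"
    using scaleR_scaleC[of 1 x] by simp
qed (simp_all add: scaleC_add_right scaleC_add_left scaleC_scaleC)

text \<open>
  Operators on a closed subspace \<open>S\<close> (itself a Hilbert space) are represented by functions on the
  ambient type of which only the values on \<open>S\<close> matter; operators on the whole space are the
  case \<open>S = UNIV\<close>.
\<close>

definition operator_on :: "'a::complex_hilbert_space set \<Rightarrow> ('a \<Rightarrow> 'a) \<Rightarrow> bool" where
  "operator_on S A \<longleftrightarrow>
     (\<forall>x\<in>S. A x \<in> S) \<and>
     (\<forall>x\<in>S. \<forall>y\<in>S. A (x + y) = A x + A y) \<and>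
     (\<forall>c. \<forall>x\<in>S. A (c *\<^sub>C x) = c *\<^sub>C A x) \<and>
     (\<exists>K. \<forall>x\<in>S. norm (A x) \<le> K * norm x)"

text \<open>
  The adjoint of an operator \<open>A\<close> on the Hilbert space \<open>S\<close>. For \<open>S\<close> a closed
  subspace and \<open>A\<close> an operator on \<open>S\<close>, the vector described exists and is
  unique by the Riesz representation theorem.
\<close>

definition adjoint_on :: "'a::complex_hilbert_space set \<Rightarrow> ('a \<Rightarrow> 'a) \<Rightarrow> 'a \<Rightarrow> 'a" where
  "adjoint_on S A y = (THE z. z \<in> S \<and> (\<forall>x\<in>S. cinner (A x) y = cinner x z))"

abbreviation cadjoint :: "('a::complex_hilbert_space \<Rightarrow> 'a) \<Rightarrow> 'a \<Rightarrow> 'a" where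
  "cadjoint \<equiv> adjoint_on UNIV"

definition contraction_on :: "'a::complex_hilbert_space set \<Rightarrow> ('a \<Rightarrow> 'a) \<Rightarrow> bool" where
  "contraction_on S A \<longleftrightarrow> operator_on S A \<and> (\<forall>x\<in>S. norm (A x) \<le> norm x)"

definition pure_contraction_on :: "'a::complex_hilbert_space set \<Rightarrow> ('a \<Rightarrow> 'a) \<Rightarrow> bool" where
  "pure_contraction_on S A \<longleftrightarrow>
     contraction_on S A \<and> (\<forall>h\<in>S. (\<lambda>m. norm ((adjoint_on S A ^^ m) h)) \<longlonglongrightarrow> 0)"

definition orth_proj :: "'a::complex_hilbert_space set \<Rightarrow> 'a \<Rightarrow> 'a" where
  "orth_proj S x = (THE y. y \<in> S \<and> (\<forall>z\<in>S. cinner (x - y) z = 0))"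

definition left_invertible :: "('a::complex_hilbert_space \<Rightarrow> 'a) \<Rightarrow> bool" where
  "left_invertible A \<longleftrightarrow> (\<exists>L. operator_on UNIV L \<and> L \<circ> A = id)"

definition cauchy_dual :: "('a::complex_hilbert_space \<Rightarrow> 'a) \<Rightarrow> 'a \<Rightarrow> 'a" where
  "cauchy_dual A = A \<circ> inv (cadjoint A \<circ> A)"

text \<open>
  An \<open>n\<close>-tuple is a function on \<^typ>\<open>nat\<close> of which only the values at \<open>1, \<dots>, n\<close> are
  used; likewise for multi-indices.
\<close>

definition doubly_commuting :: "nat \<Rightarrow> (nat \<Rightarrow> 'a::complex_hilbert_space \<Rightarrow> 'a) \<Rightarrow> bool" where
  "doubly_commuting n X \<longleftrightarrow>
     (\<forall>i\<in>{1..n}. \<forall>j\<in>{1..n}. X i \<circ> X j = X j \<circ> X i) \<and>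
     (\<forall>i\<in>{1..n}. \<forall>j\<in>{1..n}. i \<noteq> j \<longrightarrow> cadjoint (X i) \<circ> X j = X j \<circ> cadjoint (X i))"

definition wandering_subspace :: "nat \<Rightarrow> (nat \<Rightarrow> 'a::complex_hilbert_space \<Rightarrow> 'a) \<Rightarrow> 'a set" where
  "wandering_subspace n X = (\<Inter>i\<in>{1..n}. {h. cadjoint (X i) h = 0})"

text \<open>\<open>X\<^sub>1\<^bsup>k\<^sub>1\<^esup> \<cdots> X\<^sub>n\<^bsup>k\<^sub>n\<^esup>\<close>, composed in this order.\<close>

definition tuple_power :: "nat \<Rightarrow> (nat \<Rightarrow> 'a \<Rightarrow> 'a) \<Rightarrow> (nat \<Rightarrow> nat) \<Rightarrow> 'a \<Rightarrow> 'a" where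
  "tuple_power n X k = foldr (\<lambda>i f. (X i ^^ k i) \<circ> f) [1..<Suc n] id"

definition wandering_subspace_property ::
  "nat \<Rightarrow> (nat \<Rightarrow> 'a::complex_hilbert_space \<Rightarrow> 'a) \<Rightarrow> bool" where
  "wandering_subspace_property n X \<longleftrightarrow>
     closure (cvec.span (\<Union>k. tuple_power n X k ` wandering_subspace n X)) = UNIV"

end

theory Submission
  imports Defs
begin

text \<open>
  Since \<open>T\<^sup>*\<close> commutes with every \<open>X\<^sub>i\<^sup>*\<close>, the wandering subspace \<open>W\<close> is invariant under \<open>T\<^sup>*\<close>, and
  the adjoint of the compression of \<open>T\<close> to \<open>W\<close> is \<open>T\<^sup>*\<close> restricted to \<open>W\<close>. So the claim is that the
  closed subspace \<open>S\<close> of vectors \<open>h\<close> with \<open>T\<^sup>*\<^sup>m h \<rightarrow> 0\<close> is everything as soon as it contains \<open>W\<close>.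

  The main step is that \<open>h \<in> S\<close> whenever all \<open>X\<^sub>i\<^sup>* h\<close> lie in \<open>S\<close>. By double commutativity
  \<open>Q = \<Prod>\<^sub>i (1 - X\<^sub>i' X\<^sub>i\<^sup>*)\<close> maps into \<open>W\<close>; and \<open>X\<^sub>i\<^sup>* T\<^sup>*\<^sup>m h = T\<^sup>*\<^sup>m X\<^sub>i\<^sup>* h \<rightarrow> 0\<close> for all \<open>i\<close> makes
  \<open>T\<^sup>*\<^sup>m h - Q T\<^sup>*\<^sup>m h \<rightarrow> 0\<close>, so the orbit of \<open>h\<close> comes arbitrarily close to vectors of \<open>W \<subseteq> S\<close>.
  As \<open>X\<^sub>i\<^sup>*\<close> lowers the exponent of \<open>X\<^sub>i'\<close> in \<open>X'\<^sup>k w\<close>, or kills the vector when that exponent is 0,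
  induction on \<open>|k|\<close> puts all \<open>X'\<^sup>k w\<close> with \<open>w \<in> W\<close> into \<open>S\<close>, and these span a dense subspace.
\<close>

section \<open>Riesz representation\<close>

text \<open>If \<open>z\<close> represents \<open>f\<close> on \<open>S\<close>, then
  \<open>J x\<close> equals the squared distance from \<open>x\<close> to \<open>z\<close> minus the
  constant \<open>inner z z\<close>. So \<open>z\<close> is sought as the minimiser of
  \<open>J\<close> on \<open>S\<close>.\<close>

lemma riesz_representation_real:
  fixes f :: "'a::{real_inner,complete_space} \<Rightarrow> real"
  assumes S: "closed S" "subspace S" and f: "bounded_linear f"
  shows "\<exists>z\<in>S. \<forall>x\<in>S. f x = inner x z"
proof -
  interpret f: bounded_linear f by (rule f)
  obtain K where K: "\<And>x. \<bar>f x\<bar> \<le> norm x * K"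
    using f.bounded by auto
  define J where "J x = inner x x - 2 * f x" for x
  have J_lower: "- (K\<^sup>2) \<le> J x" for x
  proof -
    have "0 \<le> (norm x - K)\<^sup>2" by simp
    then show ?thesis
      using K[of x] unfolding J_def
      by (simp add: power2_diff dot_square_norm abs_le_iff algebra_simps)
  qed
  define m where "m = Inf (J ` S)"
  have bdd: "bdd_below (J ` S)"
    using J_lower by (meson bdd_belowI2)
  have "S \<noteq> {}" using S(2) subspace_0 by blast
  have m_le: "m \<le> J x" if "x \<in> S" for x
    unfolding m_def using bdd that by (simp add: cINF_lower)
  have "\<exists>x\<in>S. J x < m + 1 / real (Suc k)" for k
    using cInf_lessD[of "J ` S" "m + 1 / real (Suc k)"] \<open>S \<noteq> {}\<close>
    unfolding m_def by auto
  then obtain u where u: "\<And>k. u k \<in> S" "\<And>k. J (u k) < m + 1 / real (Suc k)"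
    by metis
  \<comment> \<open>The parallelogram law; the terms in \<open>f\<close> cancel by linearity. With
    the midpoint bounded below by \<open>m\<close>, near-minimisers are close to each other.\<close>
  have parallelogram: "(norm (x - y))\<^sup>2 = 2 * J x + 2 * J y - 4 * J ((1/2) *\<^sub>R (x + y))" for x y
    unfolding J_def
    by (simp add: f.add f.scaleR power2_norm_eq_inner inner_commute algebra_simps)
  have u_dist: "(norm (u k - u l))\<^sup>2 < 4 / real (Suc N)" if "k \<ge> N" "l \<ge> N" for k l N
  proof -
    have "m \<le> J ((1/2) *\<^sub>R (u k + u l))"
      by (intro m_le subspace_scale subspace_add S u)
    moreover have "1 / real (Suc k) \<le> 1 / real (Suc N)" "1 / real (Suc l) \<le> 1 / real (Suc N)"
      using that by (auto simp: frac_le)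
    ultimately show ?thesis
      using parallelogram[of "u k" "u l"] u(2)[of k] u(2)[of l] by linarith
  qed
  have "Cauchy u"
  proof (rule CauchyI)
    fix e :: real assume "e > 0"
    obtain N where N: "4 / e\<^sup>2 < real (Suc N)"
      using reals_Archimedean2 by (meson less_trans of_nat_less_iff lessI)
    have "norm (u k - u l) < e" if "k \<ge> N" "l \<ge> N" for k l
    proof -
      have "4 / real (Suc N) < e\<^sup>2"
        using N \<open>e > 0\<close> by (simp add: field_simps)
      then have "(norm (u k - u l))\<^sup>2 < e\<^sup>2"
        using u_dist[OF that] by linarith
      then show ?thesis
        using \<open>e > 0\<close> by (simp add: power_less_imp_less_base)
    qed
    then show "\<exists>M. \<forall>m\<ge>M. \<forall>n\<ge>M. norm (u m - u n) < e" by blast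
  qed
  then obtain z where z: "u \<longlonglongrightarrow> z"
    using Cauchy_convergent convergent_def by blast
  have zS: "z \<in> S"
    using closed_sequentially[OF S(1)] u(1) z by blast
  have Jz: "J z \<le> m"
  proof (rule LIMSEQ_le)
    show "(\<lambda>k. J (u k)) \<longlonglongrightarrow> J z"
      unfolding J_def by (intro tendsto_intros z f.tendsto)
    show "(\<lambda>k. m + 1 / real (Suc k)) \<longlonglongrightarrow> m"
      using tendsto_add[OF tendsto_const[of m] LIMSEQ_inverse_real_of_nat]
      by (simp add: inverse_eq_divide)
    show "\<exists>N. \<forall>k\<ge>N. J (u k) \<le> m + 1 / real (Suc k)"
      using u(2) less_imp_le by blast
  qed
  have "f x = inner x z" if x: "x \<in> S" for x
  proof (cases "x = 0")
    case True
    then show ?thesis by (simp add: f.zero)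
  next
    case False
    \<comment> \<open>\<open>J (z + s x) - J z\<close> is the quadratic
      \<open>s^2 (inner x x) - 2 s d\<close> in \<open>s\<close>, and \<open>t\<close> is its
      minimiser. Minimality of \<open>z\<close> then forces \<open>d = 0\<close>.\<close>
    define d t where "d = f x - inner x z" and "t = d / inner x x"
    have pos: "inner x x > 0" using False by simp
    have "J z \<le> J (z + t *\<^sub>R x)"
      using Jz m_le[of "z + t *\<^sub>R x"] S x zS by (simp add: subspace_add subspace_scale)
    then have "0 \<le> t * (t * inner x x) - 2 * t * d"
      unfolding J_def d_def
      by (simp add: f.add f.scaleR inner_commute algebra_simps)
    also have "\<dots> = - (d\<^sup>2 / inner x x)"
      using pos by (simp add: t_def power2_eq_square)
    finally have "d\<^sup>2 / inner x x \<le> 0" by simp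
    then have "d = 0"
      using pos by (simp add: divide_le_0_iff)
    then show ?thesis by (simp add: d_def)
  qed
  with zS show ?thesis by blast
qed

section \<open>From the real to the complex inner product\<close>

lemma cinner_add_right: "cinner x (y + z) = cinner x y + cinner x z"
  by (metis cinner_add_left cinner_commute complex_cnj_add)

lemma cinner_scaleC_right: "cinner x (a *\<^sub>C y) = cnj a * cinner x y"
  by (metis cinner_commute cinner_scaleC_left complex_cnj_mult)

lemma cinner_zero_left [simp]: "cinner 0 x = 0"
  using cinner_add_left[of 0 0 x] by simp

lemma cinner_zero_right [simp]: "cinner x 0 = 0"
  using cinner_add_right[of x 0 0] by simp

lemma cinner_diff_left: "cinner (x - y) z = cinner x z - cinner y z"
  using cinner_add_left[of "x - y" y z] by simp

lemma cinner_diff_right: "cinner x (y - z) = cinner x y - cinner x z"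
  using cinner_add_right[of x "y - z" z] by simp

lemma cinner_self_eq_0: "cinner x x = 0 \<Longrightarrow> x = 0"
  using inner_eq_Re_cinner[of x x] by simp

lemma cinner_eqI: "(\<And>x. cinner x y = cinner x z) \<Longrightarrow> y = z"
  by (metis cinner_diff_right cinner_self_eq_0 eq_iff_diff_eq_0)

lemma Re_cinner_le: "Re (cinner x y) \<le> norm x * norm y"
  using norm_cauchy_schwarz[of x y] by (simp add: inner_eq_Re_cinner)

lemma power2_norm_eq_cinner: "(norm x)\<^sup>2 = Re (cinner x x)"
  by (simp add: power2_norm_eq_inner inner_eq_Re_cinner)

text \<open>The imaginary part of the inner product is seen by the real one after rotating by \<open>\<i>\<close>.\<close>

lemma cinner_eq_onI:
  assumes "cvec.subspace S" "\<And>c x. A (c *\<^sub>C x) = c *\<^sub>C A x"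
    and "\<And>x. x \<in> S \<Longrightarrow> Re (cinner (A x) y) = Re (cinner x z)" and "x \<in> S"
  shows "cinner (A x) y = cinner x z"
proof (rule complex_eqI)
  show "Re (cinner (A x) y) = Re (cinner x z)"
    using assms by blast
  have "\<i> *\<^sub>C x \<in> S" using assms(1,4) by (simp add: cvec.subspace_scale)
  from assms(3)[OF this] show "Im (cinner (A x) y) = Im (cinner x z)"
    by (simp add: assms(2) cinner_scaleC_left)
qed

lemma csubspace_imp_subspace: "cvec.subspace S \<Longrightarrow> subspace S"
  unfolding subspace_def cvec.subspace_def by (simp add: scaleR_scaleC)

lemma bounded_linear_operator:
  assumes "operator_on UNIV A"
  shows "bounded_linear A"
proof -
  obtain K where "\<forall>x. norm (A x) \<le> K * norm x"
    using assms unfolding operator_on_def by auto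
  then show ?thesis
    using assms
    by (intro bounded_linear_intro[where K=K]) (auto simp: operator_on_def scaleR_scaleC mult.commute)
qed

lemma operator_scaleC: "operator_on UNIV A \<Longrightarrow> A (c *\<^sub>C x) = c *\<^sub>C A x"
  by (simp add: operator_on_def)

text \<open>The functional has the form \<open>cinner (A x) y\<close> to serve four uses: adjoints
  on the whole space, projections with \<open>A = id\<close>, adjoints of compressions, and
  inversion of \<open>A^* A\<close> through a left inverse.\<close>

lemma riesz_representation:
  assumes S: "closed S" "cvec.subspace S" and A: "operator_on UNIV A"
  shows "\<exists>!z. z \<in> S \<and> (\<forall>x\<in>S. cinner (A x) y = cinner x z)"
proof (rule ex_ex1I)
  have "bounded_linear (\<lambda>x. inner (A x) y)"
    using bounded_linear_compose[OF bounded_linear_inner_left bounded_linear_operator[OF A]] .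
  from riesz_representation_real[OF S(1) csubspace_imp_subspace[OF S(2)] this]
  obtain z where "z \<in> S" "\<forall>x\<in>S. inner (A x) y = inner x z" by blast
  then show "\<exists>z. z \<in> S \<and> (\<forall>x\<in>S. cinner (A x) y = cinner x z)"
    using cinner_eq_onI[OF S(2) operator_scaleC[OF A]] by (auto simp: inner_eq_Re_cinner)
next
  fix z z'
  assume z: "z \<in> S \<and> (\<forall>x\<in>S. cinner (A x) y = cinner x z)"
    and z': "z' \<in> S \<and> (\<forall>x\<in>S. cinner (A x) y = cinner x z')"
  have "z - z' \<in> S" using z z' S(2) by (simp add: cvec.subspace_diff)
  then have "cinner (z - z') (z - z') = 0"
    using z z' by (metis cinner_diff_right right_minus_eq)
  then show "z = z'" using cinner_self_eq_0 by fastforce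
qed

section \<open>Adjoints, projections and Cauchy duals\<close>

lemma cinner_cadjoint:
  assumes "operator_on UNIV A"
  shows "cinner (A x) y = cinner x (cadjoint A y)"
proof -
  have "cadjoint A y \<in> UNIV \<and> (\<forall>x\<in>UNIV. cinner (A x) y = cinner x (cadjoint A y))"
    unfolding adjoint_on_def
    by (rule theI'[OF riesz_representation[OF closed_UNIV cvec.subspace_UNIV assms]])
  then show ?thesis by blast
qed

lemma operator_cadjoint:
  assumes A: "operator_on UNIV A"
  shows "operator_on UNIV (cadjoint A)"
proof -
  obtain K where K: "\<And>x. norm (A x) \<le> norm x * K" "K \<ge> 0"
    using bounded_linear.nonneg_bounded[OF bounded_linear_operator[OF A]] by auto
  have "norm (cadjoint A y) \<le> K * norm y" for y
  \<comment> \<open>The estimate bounds the square of \<open>norm (cadjoint A y)\<close> by a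
    multiple of that norm, which can be cancelled only if nonzero.\<close>
  proof (cases "cadjoint A y = 0")
    case False
    have "(norm (cadjoint A y))\<^sup>2 = Re (cinner (A (cadjoint A y)) y)"
      by (simp add: power2_norm_eq_cinner cinner_cadjoint[OF A])
    also have "\<dots> \<le> norm (A (cadjoint A y)) * norm y"
      by (rule Re_cinner_le)
    also have "\<dots> \<le> norm (cadjoint A y) * K * norm y"
      by (intro mult_right_mono K) simp
    finally show ?thesis using False by (simp add: power2_eq_square)
  qed (simp add: K)
  moreover have "cadjoint A (x + y) = cadjoint A x + cadjoint A y" for x y
    by (rule cinner_eqI) (simp add: cinner_cadjoint[OF A, symmetric] cinner_add_right)
  moreover have "cadjoint A (c *\<^sub>C x) = c *\<^sub>C cadjoint A x" for c x
    by (rule cinner_eqI) (simp add: cinner_cadjoint[OF A, symmetric] cinner_scaleC_right)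
  ultimately show ?thesis unfolding operator_on_def by auto
qed

lemma cadjoint_commute:
  assumes "operator_on UNIV A" "operator_on UNIV B" "A \<circ> B = B \<circ> A"
  shows "cadjoint A (cadjoint B x) = cadjoint B (cadjoint A x)"
  by (rule cinner_eqI)
    (simp add: cinner_cadjoint[symmetric] assms(1,2) fun_cong[OF assms(3), unfolded comp_def])

text \<open>The kernel of the adjoint depends only on the range of \<open>A\<close>; operators with
  equal ranges will thus have equal adjoint kernels.\<close>

lemma cadjoint_eq_0_iff:
  assumes "operator_on UNIV A"
  shows "cadjoint A h = 0 \<longleftrightarrow> (\<forall>x. cinner (A x) h = 0)"
  by (metis assms cinner_cadjoint cinner_self_eq_0 cinner_zero_right)

lemma norm_cadjoint_le:
  assumes "contraction_on UNIV A"
  shows "norm (cadjoint A y) \<le> norm y"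
proof (cases "cadjoint A y = 0")
  case False
  have A: "operator_on UNIV A" "\<And>x. norm (A x) \<le> norm x"
    using assms by (auto simp: contraction_on_def)
  have "(norm (cadjoint A y))\<^sup>2 = Re (cinner (A (cadjoint A y)) y)"
    by (simp add: power2_norm_eq_cinner cinner_cadjoint[OF A(1)])
  also have "\<dots> \<le> norm (A (cadjoint A y)) * norm y"
    by (rule Re_cinner_le)
  also have "\<dots> \<le> norm (cadjoint A y) * norm y"
    by (intro mult_right_mono A) simp
  finally show ?thesis using False by (simp add: power2_eq_square)
qed simp

section \<open>Orthogonal projections and compressions\<close>

lemma orth_proj_ex1:
  assumes S: "closed S" "cvec.subspace S"
  shows "\<exists>!y. y \<in> S \<and> (\<forall>z\<in>S. cinner (x - y) z = 0)"
proof -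
  have "operator_on UNIV (id :: 'a \<Rightarrow> 'a)"
    unfolding operator_on_def by (auto intro: exI[of _ 1])
  moreover have "cinner (x - y) z = 0 \<longleftrightarrow> cinner (id z) x = cinner z y" for y z
    unfolding cinner_diff_left right_minus_eq
    by (metis cinner_commute id_apply)
  ultimately show ?thesis
    using riesz_representation[OF S, of id x] by simp
qed

lemma
  assumes "closed S" "cvec.subspace S"
  shows orth_proj_in: "orth_proj S x \<in> S"
    and cinner_orth_proj: "z \<in> S \<Longrightarrow> cinner (orth_proj S x) z = cinner x z"
proof -
  have *: "orth_proj S x \<in> S \<and> (\<forall>z\<in>S. cinner (x - orth_proj S x) z = 0)"
    unfolding orth_proj_def by (rule theI'[OF orth_proj_ex1[OF assms]])
  then show "orth_proj S x \<in> S" by blast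
  show "z \<in> S \<Longrightarrow> cinner (orth_proj S x) z = cinner x z"
    using * by (simp add: cinner_diff_left)
qed

lemma orth_proj_eqI:
  assumes "closed S" "cvec.subspace S" "y \<in> S" "\<And>z. z \<in> S \<Longrightarrow> cinner y z = cinner x z"
  shows "orth_proj S x = y"
  unfolding orth_proj_def
  by (rule the1_equality[OF orth_proj_ex1[OF assms(1,2)]]) (simp add: assms(3,4) cinner_diff_left)

lemma contraction_on_orth_proj_comp:
  assumes S: "closed S" "cvec.subspace S" and T: "contraction_on UNIV T"
  shows "contraction_on S (\<lambda>h. orth_proj S (T h))"
proof -
  note PS = orth_proj_in[OF S] and cP = cinner_orth_proj[OF S]
  have Top: "operator_on UNIV T" and Tn: "\<And>x. norm (T x) \<le> norm x"
    using T by (auto simp: contraction_on_def)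
  have norm_P: "norm (orth_proj S x) \<le> norm x" for x
  proof (cases "orth_proj S x = 0")
    case False
    have "(norm (orth_proj S x))\<^sup>2 = Re (cinner x (orth_proj S x))"
      by (simp add: power2_norm_eq_cinner cP PS)
    also have "\<dots> \<le> norm x * norm (orth_proj S x)"
      by (rule Re_cinner_le)
    finally show ?thesis using False by (simp add: power2_eq_square)
  qed simp
  have n: "norm (orth_proj S (T x)) \<le> norm x" for x
    using norm_P Tn order_trans by blast
  have "orth_proj S (x + y) = orth_proj S x + orth_proj S y" for x y
    by (rule orth_proj_eqI[OF S]) (auto simp: PS cP cinner_add_left S(2) cvec.subspace_add)
  moreover have "orth_proj S (c *\<^sub>C x) = c *\<^sub>C orth_proj S x" for c x
    by (rule orth_proj_eqI[OF S]) (auto simp: PS cP cinner_scaleC_left S(2) cvec.subspace_scale)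
  ultimately show ?thesis
    using Top n unfolding contraction_on_def operator_on_def
    by (auto simp: PS intro!: exI[of _ 1])
qed

text \<open>Pairing with \<open>h\<close> in \<open>S\<close> makes the projection invisible, so
  \<open>T^* h\<close> has the defining property of the adjoint, and invariance keeps it in
  \<open>S\<close>.\<close>

lemma adjoint_on_compression:
  assumes S: "closed S" "cvec.subspace S" and T: "operator_on UNIV T"
    and inv: "\<And>h. h \<in> S \<Longrightarrow> cadjoint T h \<in> S" and h: "h \<in> S"
  shows "adjoint_on S (\<lambda>h. orth_proj S (T h)) h = cadjoint T h"
proof (subst adjoint_on_def, rule the1_equality)
  have "(\<forall>x\<in>S. cinner (orth_proj S (T x)) h = cinner x z) \<longleftrightarrow> (\<forall>x\<in>S. cinner (T x) h = cinner x z)" for z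
    by (simp add: cinner_orth_proj[OF S] h)
  then show "\<exists>!z. z \<in> S \<and> (\<forall>x\<in>S. cinner (orth_proj S (T x)) h = cinner x z)"
    using riesz_representation[OF S T, of h] by simp
  show "cadjoint T h \<in> S \<and> (\<forall>x\<in>S. cinner (orth_proj S (T x)) h = cinner x (cadjoint T h))"
    by (simp add: cinner_orth_proj[OF S] h inv cinner_cadjoint[OF T])
qed

section \<open>Left-invertible operators and their Cauchy duals\<close>

lemma bij_cadjoint_comp:
  assumes A: "operator_on UNIV A" and L: "operator_on UNIV L" and LA: "\<And>x. L (A x) = x"
  shows "bij (cadjoint A \<circ> A)"
proof (rule bijI)
  interpret A: bounded_linear A by (rule bounded_linear_operator[OF A])
  interpret L: bounded_linear L by (rule bounded_linear_operator[OF L])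
  interpret A': bounded_linear "cadjoint A"
    by (rule bounded_linear_operator[OF operator_cadjoint[OF A]])
  show "inj (cadjoint A \<circ> A)"
  proof (rule injI)
    fix x y assume "(cadjoint A \<circ> A) x = (cadjoint A \<circ> A) y"
    then have "cadjoint A (A (x - y)) = 0" by (simp add: A.diff A'.diff)
    then have "cinner (A (x - y)) (A (x - y)) = 0"
      by (simp add: cinner_cadjoint[OF A])
    then have "A (x - y) = 0" by (rule cinner_self_eq_0)
    then show "x = y" using LA[of "x - y"] by (simp add: L.zero)
  qed
  \<comment> \<open>The range is the fixed-point set of the continuous map \<open>A L\<close>, hence
    closed.\<close>
  have range_A: "range A = {v. A (L v) = v}"
    using LA by auto (metis rangeI)
  have "closed (range A)"
    unfolding range_A
    by (intro closed_Collect_eq continuous_intros A.continuous_on L.continuous_on)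
  moreover have "cvec.subspace (range A)"
    unfolding cvec.subspace_def range_A
    using A L by (auto simp: operator_on_def A.zero L.zero)
  ultimately have *: "\<exists>!z. z \<in> range A \<and> (\<forall>x\<in>range A. cinner (L x) y = cinner x z)" for y
    by (rule riesz_representation[OF _ _ L])
  show "surj (cadjoint A \<circ> A)"
    unfolding surj_def
  proof
    fix y
    \<comment> \<open>Represent \<open>cinner (L v) y\<close> for \<open>v\<close> in
      \<open>range A\<close> by a vector \<open>A x\<close>, then put \<open>v = A z\<close>. The
      resulting identity says that \<open>x\<close> solves \<open>A^* A x = y\<close>.\<close>
    obtain x where x: "\<And>z. cinner z y = cinner (A z) (A x)"
      using *[of y] LA by auto
    have "cadjoint A (A x) = y"
      by (rule cinner_eqI) (simp add: cinner_cadjoint[OF A, symmetric] x[symmetric])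
    then show "\<exists>x. y = (cadjoint A \<circ> A) x" by auto
  qed
qed

lemma left_invertible_iff: "left_invertible A \<longleftrightarrow> (\<exists>L. operator_on UNIV L \<and> (\<forall>x. L (A x) = x))"
  unfolding left_invertible_def by (simp add: fun_eq_iff)

lemma
  assumes A: "operator_on UNIV A" and left: "left_invertible A"
  shows cadjoint_cauchy_dual: "cadjoint A (cauchy_dual A x) = x"
    and operator_cauchy_dual: "operator_on UNIV (cauchy_dual A)"
    and cadjoint_cauchy_dual_eq_0_iff: "cadjoint (cauchy_dual A) h = 0 \<longleftrightarrow> cadjoint A h = 0"
proof -
  obtain L where L: "operator_on UNIV L" and LA: "\<And>x. L (A x) = x"
    using left by (auto simp: left_invertible_iff)
  interpret L: bounded_linear L by (rule bounded_linear_operator[OF L])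
  define B where "B = inv (cadjoint A \<circ> A)"
  note bij = bij_cadjoint_comp[OF A L LA]
  have AB: "cadjoint A (A (B x)) = x" for x
    using surj_f_inv_f[OF bij_is_surj[OF bij], of x] by (simp add: B_def)
  have BA: "B (cadjoint A (A x)) = x" for x
    using inv_f_f[OF bij_is_inj[OF bij], of x] by (simp add: B_def)
  have dual: "cauchy_dual A x = A (B x)" for x
    by (simp add: cauchy_dual_def B_def)
  show "cadjoint A (cauchy_dual A x) = x"
    by (simp add: dual AB)
  obtain K where K: "\<And>x. norm (L x) \<le> norm x * K" "K \<ge> 0"
    using L.nonneg_bounded by auto
  \<comment> \<open>The squared norm is \<open>cinner (B y) y\<close> because
    \<open>A^* A B = 1\<close>. Writing \<open>B y\<close> as \<open>L (A (B y))\<close> bounds the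
    dual by the constant of \<open>L\<close>.\<close>
  have "norm (A (B y)) \<le> K * norm y" for y
  proof (cases "A (B y) = 0")
    case False
    have "(norm (A (B y)))\<^sup>2 = Re (cinner (L (A (B y))) y)"
      by (simp add: power2_norm_eq_cinner cinner_cadjoint[OF A] AB LA)
    also have "\<dots> \<le> norm (L (A (B y))) * norm y"
      by (rule Re_cinner_le)
    also have "\<dots> \<le> norm (A (B y)) * K * norm y"
      by (intro mult_right_mono K) simp
    finally show ?thesis using False by (simp add: power2_eq_square)
  qed (simp add: K)
  moreover have "B (x + y) = B x + B y" for x y
  proof -
    have "cadjoint A (A (B x + B y)) = x + y"
      using A operator_cadjoint[OF A] by (simp add: operator_on_def AB)
    then show ?thesis by (metis BA)
  qed
  moreover have "B (c *\<^sub>C x) = c *\<^sub>C B x" for c x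
  proof -
    have "cadjoint A (A (c *\<^sub>C B x)) = c *\<^sub>C x"
      using A operator_cadjoint[OF A] by (simp add: operator_on_def AB)
    then show ?thesis by (metis BA)
  qed
  ultimately show op: "operator_on UNIV (cauchy_dual A)"
    using A unfolding operator_on_def dual by auto
  \<comment> \<open>\<open>B\<close> is onto by \<open>BA\<close>, so \<open>A\<close> and its dual
    \<open>A B\<close> have the same range.\<close>
  show "cadjoint (cauchy_dual A) h = 0 \<longleftrightarrow> cadjoint A h = 0"
    unfolding cadjoint_eq_0_iff[OF A] cadjoint_eq_0_iff[OF op] dual by (metis BA)
qed

text \<open>A map commuting with \<open>A\<close> and \<open>A^*\<close> commutes with
  \<open>A^* A\<close> and so with its inverse. Double commutativity supplies both conditions for
  \<open>C = X_i^*\<close> and \<open>A = X_j\<close>, where \<open>i\<close> and \<open>j\<close>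
  differ.\<close>

lemma cauchy_dual_commute:
  assumes A: "operator_on UNIV A" and left: "left_invertible A"
    and "\<And>x. C (A x) = A (C x)" "\<And>x. C (cadjoint A x) = cadjoint A (C x)"
  shows "C (cauchy_dual A x) = cauchy_dual A (C x)"
proof -
  obtain L where L: "operator_on UNIV L" "\<And>x. L (A x) = x"
    using left by (auto simp: left_invertible_iff)
  note bij = bij_cadjoint_comp[OF A L]
  define z where "z = inv (cadjoint A \<circ> A) x"
  have "x = (cadjoint A \<circ> A) z"
    unfolding z_def by (rule surj_f_inv_f[OF bij_is_surj[OF bij], symmetric])
  then have "C x = (cadjoint A \<circ> A) (C z)"
    by (simp add: assms)
  then have "inv (cadjoint A \<circ> A) (C x) = C z"
    by (simp only: inv_f_f[OF bij_is_inj[OF bij]])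
  then show ?thesis
    by (simp add: cauchy_dual_def assms z_def)
qed

section \<open>Approximation by the joint kernel\<close>

text \<open>
  Here \<open>Y i\<close> and \<open>Z i\<close> are \<open>X\<^sub>i\<^sup>*\<close> and \<open>X\<^sub>i'\<close>; the product of the idempotents \<open>1 - Z i Y i\<close> maps
  onto the joint kernel of the \<open>Y i\<close>.
\<close>

primrec defect :: "(nat \<Rightarrow> 'a \<Rightarrow> 'a) \<Rightarrow> (nat \<Rightarrow> 'a \<Rightarrow> 'a) \<Rightarrow> nat \<Rightarrow> 'a::real_normed_vector \<Rightarrow> 'a" where
  "defect Y Z 0 h = h"
| "defect Y Z (Suc j) h = defect Y Z j h - Z (Suc j) (Y (Suc j) (defect Y Z j h))"

text \<open>The factor \<open>1 - Z i Y i\<close> has range in the kernel of \<open>Y i\<close>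
  because \<open>Y i Z i = 1\<close>, and later factors commute with \<open>Y i\<close>, so the zero
  persists. The second claim telescopes \<open>1 - Q\<close> over the factors.\<close>

lemma
  fixes Y Z :: "nat \<Rightarrow> 'a::real_normed_vector \<Rightarrow> 'a"
  assumes Y: "\<And>i. i \<in> {1..n} \<Longrightarrow> bounded_linear (Y i)"
    and Z: "\<And>i. i \<in> {1..n} \<Longrightarrow> bounded_linear (Z i)"
    and YZ: "\<And>i h. i \<in> {1..n} \<Longrightarrow> Y i (Z i h) = h"
    and YY: "\<And>i j h. i \<in> {1..n} \<Longrightarrow> j \<in> {1..n} \<Longrightarrow> Y i (Y j h) = Y j (Y i h)"
    and YZ': "\<And>i j h. i \<in> {1..n} \<Longrightarrow> j \<in> {1..n} \<Longrightarrow> i \<noteq> j \<Longrightarrow> Y i (Z j h) = Z j (Y i h)"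
  shows defect_in_ker: "1 \<le> i \<Longrightarrow> i \<le> j \<Longrightarrow> j \<le> n \<Longrightarrow> Y i (defect Y Z j h) = 0"
    and defect_tendsto: "(\<And>i. i \<in> {1..n} \<Longrightarrow> (\<lambda>m. Y i (f m)) \<longlonglongrightarrow> 0) \<Longrightarrow> j \<le> n \<Longrightarrow>
      (\<lambda>m::nat. f m - defect Y Z j (f m)) \<longlonglongrightarrow> 0"
proof -
  have diff: "Y i (a - b) = Y i a - Y i b" if "i \<in> {1..n}" for i a b
    using bounded_linear.linear[OF Y[OF that]] by (rule linear_diff)
  have Y0: "Y i 0 = 0" if "i \<in> {1..n}" for i
    using bounded_linear.linear[OF Y[OF that]] by (rule linear_0)
  have Z0: "Z i 0 = 0" if "i \<in> {1..n}" for i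
    using bounded_linear.linear[OF Z[OF that]] by (rule linear_0)
  have comm: "j < i \<Longrightarrow> i \<le> n \<Longrightarrow> Y i (defect Y Z j h) = defect Y Z j (Y i h)" for i j h
  proof (induction j)
    case (Suc j)
    then show ?case by (simp add: diff YZ' YY[of i "Suc j"])
  qed simp
  show "1 \<le> i \<Longrightarrow> i \<le> j \<Longrightarrow> j \<le> n \<Longrightarrow> Y i (defect Y Z j h) = 0" for i j h
  proof (induction j)
    case (Suc j)
    show ?case
    proof (cases "i = Suc j")
      case True
      with Suc.prems show ?thesis by (simp add: diff YZ)
    next
      case False
      with Suc.prems have "Y i (defect Y Z j h) = 0" by (intro Suc.IH) auto
      with False Suc.prems show ?thesis
        by (simp add: diff YZ' YY[of i "Suc j"] Y0 Z0)
    qed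
  qed simp
  have defect_zero: "j \<le> n \<Longrightarrow> (\<And>g. g \<longlonglongrightarrow> 0 \<Longrightarrow> (\<lambda>m::nat. defect Y Z j (g m)) \<longlonglongrightarrow> 0)" for j
  proof (induction j)
    case (Suc j)
    then have "(\<lambda>m. defect Y Z j (g m)) \<longlonglongrightarrow> 0" by simp
    then have "(\<lambda>m. defect Y Z j (g m) - Z (Suc j) (Y (Suc j) (defect Y Z j (g m))))
      \<longlonglongrightarrow> 0 - Z (Suc j) (Y (Suc j) 0)"
      using Suc.prems by (intro tendsto_diff bounded_linear.tendsto[OF Z] bounded_linear.tendsto[OF Y]) auto
    then show ?case using Suc.prems by (simp add: Y0 Z0)
  qed simp
  show "(\<lambda>m::nat. f m - defect Y Z j (f m)) \<longlonglongrightarrow> 0"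
    if f: "\<And>i. i \<in> {1..n} \<Longrightarrow> (\<lambda>m. Y i (f m)) \<longlonglongrightarrow> 0" and "j \<le> n"
    using \<open>j \<le> n\<close>
  proof (induction j)
    case (Suc j)
    \<comment> \<open>By \<open>comm\<close>, \<open>Y (Suc j)\<close> moves past the earlier
      factors onto \<open>f m\<close>, where it gives a null sequence; \<open>defect_zero\<close>
      preserves this.\<close>
    have "(\<lambda>m. Y (Suc j) (defect Y Z j (f m))) \<longlonglongrightarrow> 0"
      using defect_zero[of j "\<lambda>m. Y (Suc j) (f m)"] f[of "Suc j"] Suc.prems by (simp add: comm)
    then have "(\<lambda>m. (f m - defect Y Z j (f m)) + Z (Suc j) (Y (Suc j) (defect Y Z j (f m))))
      \<longlonglongrightarrow> 0 + Z (Suc j) 0"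
      using Suc by (intro tendsto_add bounded_linear.tendsto[OF Z]) auto
    then show ?case using Suc.prems by (simp add: Z0 algebra_simps)
  qed simp
qed

section \<open>Stable vectors of a contraction\<close>

lemma funpow_bounded_linear:
  fixes A :: "'a::real_normed_vector \<Rightarrow> 'a"
  assumes "bounded_linear A"
  shows "bounded_linear (A ^^ m)"
proof (induction m)
  case (Suc m)
  show ?case
    using bounded_linear_compose[OF assms Suc.IH] by (simp add: comp_def)
qed (simp add: id_def bounded_linear_ident)

lemma funpow_norm_le:
  fixes A :: "'a::real_normed_vector \<Rightarrow> 'a"
  assumes "\<And>x. norm (A x) \<le> norm x"
  shows "norm ((A ^^ m) x) \<le> norm x"
  by (induction m) (auto intro: order_trans assms)

text \<open>All powers of \<open>A\<close> are contractions, so the error made on replacing the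
  limit by a nearby stable vector is uniform in the exponent.\<close>

lemma closed_stable:
  fixes A :: "'a::real_normed_vector \<Rightarrow> 'a"
  assumes A: "bounded_linear A" "\<And>x. norm (A x) \<le> norm x"
  shows "closed {h. (\<lambda>m. (A ^^ m) h) \<longlonglongrightarrow> 0}"
proof (rule closed_sequential_limits[THEN iffD2], intro allI impI, elim conjE)
  fix u l assume u: "\<forall>k. u k \<in> {h. (\<lambda>m. (A ^^ m) h) \<longlonglongrightarrow> 0}" and l: "u \<longlonglongrightarrow> l"
  have "(\<lambda>m. (A ^^ m) l) \<longlonglongrightarrow> 0"
  proof (rule LIMSEQ_I)
    fix e :: real assume e: "e > 0"
    obtain k where k: "norm (u k - l) < e / 2"
      using LIMSEQ_D[OF l, of "e / 2"] e by fastforce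
    obtain N where N: "\<And>m. m \<ge> N \<Longrightarrow> norm ((A ^^ m) (u k)) < e / 2"
      using LIMSEQ_D[of "\<lambda>m. (A ^^ m) (u k)" 0 "e / 2"] u e by auto
    have "norm ((A ^^ m) l - 0) < e" if "m \<ge> N" for m
    proof -
      have "(A ^^ m) l = (A ^^ m) (u k) - (A ^^ m) (u k - l)"
        using bounded_linear.linear[OF funpow_bounded_linear[OF A(1)]] by (simp add: linear_diff)
      then have "norm ((A ^^ m) l) \<le> norm ((A ^^ m) (u k)) + norm ((A ^^ m) (u k - l))"
        by (metis norm_triangle_ineq4)
      then show ?thesis
        using N[OF that] k funpow_norm_le[OF A(2), of m "u k - l"] by simp
    qed
    then show "\<exists>N. \<forall>m\<ge>N. norm ((A ^^ m) l - 0) < e" by blast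
  qed
  then show "l \<in> {h. (\<lambda>m. (A ^^ m) h) \<longlonglongrightarrow> 0}" by simp
qed

lemma csubspace_stable:
  assumes A: "operator_on UNIV A"
  shows "cvec.subspace {h. (\<lambda>m. (A ^^ m) h) \<longlonglongrightarrow> 0}"
proof -
  have lin: "linear (A ^^ m)" for m
    using bounded_linear.linear[OF funpow_bounded_linear[OF bounded_linear_operator[OF A]]] .
  have sc: "(A ^^ m) (c *\<^sub>C h) = c *\<^sub>C (A ^^ m) h" for m c h
    by (induction m) (simp_all add: operator_scaleC[OF A])
  \<comment> \<open>The class links the norm directly to real scaling only; complex homogeneity
    comes from \<open>cinner\<close>.\<close>
  have norm_sc: "norm (c *\<^sub>C h) = cmod c * norm h" for c and h :: 'a
  proof -
    have "c * cnj c = complex_of_real ((cmod c)\<^sup>2)"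
      by (rule complex_norm_square[symmetric])
    then have "cinner (c *\<^sub>C h) (c *\<^sub>C h) = complex_of_real ((cmod c)\<^sup>2) * cinner h h"
      by (metis cinner_scaleC_left cinner_scaleC_right mult.assoc)
    then have "(norm (c *\<^sub>C h))\<^sup>2 = (cmod c)\<^sup>2 * (norm h)\<^sup>2"
      unfolding power2_norm_eq_cinner by simp
    also have "\<dots> = (cmod c * norm h)\<^sup>2"
      by (simp add: power_mult_distrib)
    finally show ?thesis by simp
  qed
  have "(\<lambda>m. c *\<^sub>C (A ^^ m) h) \<longlonglongrightarrow> 0" if "(\<lambda>m. (A ^^ m) h) \<longlonglongrightarrow> 0" for c h
    using tendsto_mult_right_zero[OF tendsto_norm_zero[OF that], of "cmod c"]
    by - (rule tendsto_norm_zero_cancel, simp add: norm_sc)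
  then show ?thesis
    unfolding cvec.subspace_def
    using tendsto_add[of _ "0::'a" _ _ 0] by (auto simp: linear_0[OF lin] linear_add[OF lin] sc)
qed

text \<open>
  If \<open>f\<^sub>m = A\<^sup>m h\<close> comes arbitrarily close to stable vectors, then \<open>h\<close> itself is stable, because
  the norms of the \<open>f\<^sub>m\<close> decrease.
\<close>

lemma stableI:
  fixes A :: "'a::real_normed_vector \<Rightarrow> 'a"
  assumes A: "bounded_linear A" "\<And>x. norm (A x) \<le> norm x"
    and g: "\<And>m. (\<lambda>p. (A ^^ p) (g m)) \<longlonglongrightarrow> 0"
    and close: "(\<lambda>m. (A ^^ m) h - g m) \<longlonglongrightarrow> 0"
  shows "(\<lambda>m. (A ^^ m) h) \<longlonglongrightarrow> 0"
proof -
  show ?thesis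
  proof (rule LIMSEQ_I)
    fix e :: real assume e: "e > 0"
    obtain M where M: "norm ((A ^^ M) h - g M) < e / 2"
      using LIMSEQ_D[OF close, of "e / 2"] e by fastforce
    obtain N where N: "\<And>p. p \<ge> N \<Longrightarrow> norm ((A ^^ p) (g M)) < e / 2"
      using LIMSEQ_D[OF g[of M], of "e / 2"] e by auto
    have "norm ((A ^^ m) h - 0) < e" if m: "m \<ge> N + M" for m
    proof -
      obtain p where p: "m = p + M" "p \<ge> N"
        using m by (intro that[of "m - M"]) auto
      have "(A ^^ m) h = (A ^^ p) ((A ^^ M) h - g M) + (A ^^ p) (g M)"
        using bounded_linear.linear[OF funpow_bounded_linear[OF A(1)]]
        by (simp add: linear_diff p funpow_add)
      then have "norm ((A ^^ m) h) \<le> norm ((A ^^ p) ((A ^^ M) h - g M)) + norm ((A ^^ p) (g M))"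
        by (metis norm_triangle_ineq)
      then show ?thesis
        using N[OF p(2)] M funpow_norm_le[OF A(2), of p "(A ^^ M) h - g M"] by simp
    qed
    then show "\<exists>N. \<forall>m\<ge>N. norm ((A ^^ m) h - 0) < e" by blast
  qed
qed

section \<open>Powers of a tuple\<close>

lemma funpow_commute_pointwise: "(\<And>x. C (B x) = B (C x)) \<Longrightarrow> C ((B ^^ m) x) = (B ^^ m) (C x)"
  by (induction m) simp_all

text \<open>\<open>tuple_power\<close> over an arbitrary index list, to allow induction on the
  list.\<close>

definition partial_power :: "nat list \<Rightarrow> (nat \<Rightarrow> 'a \<Rightarrow> 'a) \<Rightarrow> (nat \<Rightarrow> nat) \<Rightarrow> 'a \<Rightarrow> 'a" where
  "partial_power is Z k = foldr (\<lambda>i f. (Z i ^^ k i) \<circ> f) is id"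

lemma partial_power_simps [simp]:
  "partial_power [] Z k x = x"
  "partial_power (i # is) Z k x = (Z i ^^ k i) (partial_power is Z k x)"
  by (simp_all add: partial_power_def)

text \<open>Asking for commutation only where \<open>k j\<close> is nonzero lets \<open>Y i\<close>
  pass when \<open>k i = 0\<close>, although it need not commute with \<open>Z i\<close>.
  \<open>C\<close> need not be linear.\<close>

lemma partial_power_commute:
  assumes "\<And>j x. j \<in> set is \<Longrightarrow> k j \<noteq> 0 \<Longrightarrow> C (Z j x) = Z j (C x)"
  shows "C (partial_power is Z k x) = partial_power is Z k (C x)"
  using assms
proof (induction "is")
  case (Cons a "is")
  then show ?case by (cases "k a = 0") (simp_all add: funpow_commute_pointwise)
qed simp

lemma partial_power_cong:
  "(\<And>j. j \<in> set is \<Longrightarrow> k j = l j) \<Longrightarrow> partial_power is Z k x = partial_power is Z l x"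
  by (induction "is") auto

text \<open>\<open>C\<close> moves to the block of \<open>Z i\<close> and cancels one factor there.
  Distinctness ensures that the tail after this block does not see the changed exponent.\<close>

lemma left_inverse_partial_power:
  assumes "distinct is" "i \<in> set is" "k i > 0"
    and "\<And>x. C (Z i x) = x"
    and "\<And>j x. j \<in> set is \<Longrightarrow> j \<noteq> i \<Longrightarrow> C (Z j x) = Z j (C x)"
  shows "C (partial_power is Z k x) = partial_power is Z (k(i := k i - 1)) x"
  using assms
proof (induction "is")
  case (Cons a "is")
  show ?case
  proof (cases "a = i")
    case True
    define l where "l = k(i := k i - 1)"
    have "k i = Suc (l i)" using Cons.prems(3) by (simp add: l_def)
    moreover have "partial_power is Z k x = partial_power is Z l x"
      using True Cons.prems(1) by (intro partial_power_cong) (auto simp: l_def)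
    ultimately show ?thesis
      unfolding l_def[symmetric] using True Cons.prems(4) by simp
  next
    case False
    then show ?thesis using Cons by (simp add: funpow_commute_pointwise)
  qed
qed simp

section \<open>Purity and the wandering subspace\<close>

theorem theorem1p6:
  fixes T :: "'a::complex_hilbert_space \<Rightarrow> 'a"
    and X :: "nat \<Rightarrow> 'a \<Rightarrow> 'a"
    and n :: nat
  assumes "n \<ge> 1"
    and "contraction_on UNIV T"
    and "\<And>i. i \<in> {1..n} \<Longrightarrow> operator_on UNIV (X i)"
    and "\<And>i. i \<in> {1..n} \<Longrightarrow> left_invertible (X i)"
    and "doubly_commuting n X"
    and "\<And>i. i \<in> {1..n} \<Longrightarrow> X i \<circ> T = T \<circ> X i"
    and "wandering_subspace_property n X"
    and "wandering_subspace_property n (\<lambda>i. cauchy_dual (X i))"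
  shows "pure_contraction_on UNIV T \<longleftrightarrow>
    pure_contraction_on (wandering_subspace n X)
      (\<lambda>h. orth_proj (wandering_subspace n X) (T h))"
proof -
  note X = assms(3) and left = assms(4)
  define Y where "Y i = cadjoint (X i)" for i
  define Z where "Z i = cauchy_dual (X i)" for i
  define A where "A = cadjoint T"
  let ?W = "wandering_subspace n X"
  let ?S = "{h. (\<lambda>m. (A ^^ m) h) \<longlonglongrightarrow> 0}"
  have T: "operator_on UNIV T"
    using assms(2) by (simp add: contraction_on_def)
  have A: "operator_on UNIV A" "bounded_linear A" "\<And>x. norm (A x) \<le> norm x"
    using operator_cadjoint[OF T] bounded_linear_operator norm_cadjoint_le[OF assms(2)]
    by (auto simp: A_def)
  have Yop: "operator_on UNIV (Y i)" if "i \<in> {1..n}" for i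
    using operator_cadjoint[OF X[OF that]] by (simp add: Y_def)
  have Y: "bounded_linear (Y i)" if "i \<in> {1..n}" for i
    using bounded_linear_operator[OF Yop[OF that]] .
  have Z: "bounded_linear (Z i)" if "i \<in> {1..n}" for i
    using bounded_linear_operator[OF operator_cauchy_dual[OF X[OF that] left[OF that]]]
    by (simp add: Z_def)
  have YZ: "Y i (Z i h) = h" if "i \<in> {1..n}" for i h
    using cadjoint_cauchy_dual[OF X[OF that] left[OF that]] by (simp add: Y_def Z_def)
  have YY: "Y i (Y j h) = Y j (Y i h)" if "i \<in> {1..n}" "j \<in> {1..n}" for i j h
    unfolding Y_def using assms(5) that by (intro cadjoint_commute X) (auto simp: doubly_commuting_def)
  have YX: "Y i (X j h) = X j (Y i h)" if "i \<in> {1..n}" "j \<in> {1..n}" "i \<noteq> j" for i j h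
    using assms(5) that unfolding Y_def doubly_commuting_def comp_def by metis
  have YZ': "Y i (Z j h) = Z j (Y i h)" if "i \<in> {1..n}" "j \<in> {1..n}" "i \<noteq> j" for i j h
    unfolding Z_def
    using cauchy_dual_commute[OF X[OF that(2)] left[OF that(2)], of "Y i"] YX[OF that]
      YY[OF that(1,2)] by (auto simp: Y_def)
  have YA: "Y i (A h) = A (Y i h)" if "i \<in> {1..n}" for i h
    unfolding Y_def A_def using assms(6) that by (intro cadjoint_commute X T) auto
  have W: "h \<in> ?W \<longleftrightarrow> (\<forall>i\<in>{1..n}. Y i h = 0)" for h
    by (auto simp: wandering_subspace_def Y_def)
  \<comment> \<open>The tuple of duals has the same wandering subspace, so its wandering subspace
    property generates the whole space from \<open>?W\<close>.\<close>
  have W_dual: "wandering_subspace n (\<lambda>i. cauchy_dual (X i)) = ?W"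
    unfolding wandering_subspace_def
    using cadjoint_cauchy_dual_eq_0_iff[OF X left] by auto
  have Y0: "Y i 0 = 0" if "i \<in> {1..n}" for i
    using bounded_linear.linear[OF Y[OF that]] by (rule linear_0)
  have Z0: "Z i 0 = 0" if "i \<in> {1..n}" for i
    using bounded_linear.linear[OF Z[OF that]] by (rule linear_0)
  have A0: "A 0 = 0"
    using bounded_linear.linear[OF A(2)] by (rule linear_0)
  have W_closed: "closed ?W"
    unfolding wandering_subspace_def Y_def[symmetric]
    by (intro closed_INT ballI closed_Collect_eq continuous_on_const linear_continuous_on Y)
  have W_sub: "cvec.subspace ?W"
    unfolding cvec.subspace_def using Yop Y0 by (auto simp: W operator_on_def)
  have A_W: "A h \<in> ?W" if "h \<in> ?W" for h
    using that by (simp add: W YA A0)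
  \<comment> \<open>Membership in \<open>?W\<close> is carried through the induction, as the adjoint
    of the compression is identified with \<open>A\<close> only there.\<close>
  have adj: "(adjoint_on ?W (\<lambda>h. orth_proj ?W (T h)) ^^ m) h = (A ^^ m) h \<and> (A ^^ m) h \<in> ?W"
    if "h \<in> ?W" for m h
    using that adjoint_on_compression[OF W_closed W_sub T] A_W by (induction m) (auto simp: A_def)
  have pure_T: "pure_contraction_on UNIV T \<longleftrightarrow> ?S = UNIV"
    using assms(2) unfolding pure_contraction_on_def A_def[symmetric] tendsto_norm_zero_iff by auto
  have pure_W: "pure_contraction_on ?W (\<lambda>h. orth_proj ?W (T h)) \<longleftrightarrow> ?W \<subseteq> ?S"
    using contraction_on_orth_proj_comp[OF W_closed W_sub assms(2)] adj
    unfolding pure_contraction_on_def tendsto_norm_zero_iff by auto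
  \<comment> \<open>By \<open>pure_T\<close> and \<open>pure_W\<close>, this is the implication from
    (ii) to (i); the other one is the trivial inclusion of \<open>?W\<close> in
    \<open>UNIV\<close>.\<close>
  have "?S = UNIV" if WS: "?W \<subseteq> ?S"
  proof -
    note defect_facts = defect_in_ker[where Y = Y and Z = Z and n = n, OF Y Z YZ YY YZ']
      defect_tendsto[where Y = Y and Z = Z and n = n, OF Y Z YZ YY YZ']
    have S_if: "h \<in> ?S" if h: "\<And>i. i \<in> {1..n} \<Longrightarrow> Y i h \<in> ?S" for h
    proof -
      have "defect Y Z n ((A ^^ m) h) \<in> ?W" for m
        unfolding W using defect_facts(1) by auto
      moreover have "(\<lambda>m. Y i ((A ^^ m) h)) \<longlonglongrightarrow> 0" if "i \<in> {1..n}" for i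
        using h[OF that] funpow_commute_pointwise[of "Y i" A, OF YA[OF that]] by simp
      then have "(\<lambda>m. (A ^^ m) h - defect Y Z n ((A ^^ m) h)) \<longlonglongrightarrow> 0"
        by (intro defect_facts(2)) auto
      ultimately show ?thesis
        using stableI[OF A(2,3), of "\<lambda>m. defect Y Z n ((A ^^ m) h)"] WS by blast
    qed
    have power_S: "partial_power [1..<Suc n] Z k w \<in> ?S" if w: "w \<in> ?W" for k w
    \<comment> \<open>Total degree 0 needs no separate base case: then every \<open>k i\<close> is
      0, each \<open>Y i\<close> kills the vector, and \<open>S_if\<close> applies.\<close>
    proof (induction "\<Sum>i\<in>{1..n}. k i" arbitrary: k rule: less_induct)
      case less
      show ?case
      proof (rule S_if)
        fix i assume i: "i \<in> {1..n}"
        show "Y i (partial_power [1..<Suc n] Z k w) \<in> ?S"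
        proof (cases "k i = 0")
          case True
          have "Y i (partial_power [1..<Suc n] Z k w) = partial_power [1..<Suc n] Z k (Y i w)"
          proof (rule partial_power_commute)
            fix j x assume "j \<in> set [1..<Suc n]" "k j \<noteq> 0"
            then have "j \<in> {1..n}" "i \<noteq> j" using True by auto
            then show "Y i (Z j x) = Z j (Y i x)" by (rule YZ'[OF i])
          qed
          also have "\<dots> = partial_power [1..<Suc n] Z k 0"
            using w i by (simp add: W)
          \<comment> \<open>Commutation with the constant map 0 says precisely that the power fixes
            0.\<close>
          also have "\<dots> = 0"
            using Z0 by (intro partial_power_commute[where C = "\<lambda>_. 0", symmetric]) auto
          finally show ?thesis using W WS Y0 by force
        next
          case False
          have "(\<Sum>j\<in>{1..n}. (k(i := k i - 1)) j) < (\<Sum>j\<in>{1..n}. k j)"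
            using i False by (intro sum_strict_mono_ex1) auto
          from less[OF this]
          have "partial_power [1..<Suc n] Z (k(i := k i - 1)) w \<in> ?S" .
          moreover have "Y i (partial_power [1..<Suc n] Z k w)
            = partial_power [1..<Suc n] Z (k(i := k i - 1)) w"
          proof (rule left_inverse_partial_power)
            fix j x assume "j \<in> set [1..<Suc n]" "j \<noteq> i"
            then have "j \<in> {1..n}" "i \<noteq> j" by auto
            then show "Y i (Z j x) = Z j (Y i x)" by (rule YZ'[OF i])
          qed (use i False YZ[OF i] in auto)
          ultimately show ?thesis by simp
        qed
      qed
    qed
    have "closure (cvec.span (\<Union>k. tuple_power n Z k ` ?W)) \<subseteq> ?S"
      using power_S
      by (intro closure_minimal cvec.span_minimal closed_stable csubspace_stable A)
        (auto simp: tuple_power_def partial_power_def)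
    moreover have "closure (cvec.span (\<Union>k. tuple_power n Z k ` ?W)) = UNIV"
      using assms(8) unfolding wandering_subspace_property_def W_dual Z_def .
    ultimately show ?thesis by blast
  qed
  then show ?thesis
    unfolding pure_T pure_W by blast
qed

end
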